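(* Let $A\in\mathbb{S}^n$, let $k\le n$, let $\widehat V$ be an $n\times k$ matrix with orthonormal columns, and let $\widehat\Lambda$ be a $k\times k$ positive semidefinite matrix with $\widehat\Lambda=\widehat V^TA\widehat V$. Let $\widehat V_\perp$ be an $n\times(n-k)$ matrix with orthonormal columns spanning the nullspace of $\widehat V^T$, and suppose that $\widehat V_\perp^TA\widehat V_\perp\preceq 0$. Put $R := A\widehat V-\widehat V\widehat\Lambda$. Then $$\|\widehat V\widehat\Lambda\widehat V^T-\Pi_+(A)\|_F^2\le 2\|R\|_F^2 .$$
   Context: $\mathbb{S}^n$ is the set of $n\times n$ Hermitian matrices (real symmetric in the real case), and $^T$ denotes the transpose (conjugate transpose in the complex case). $\|\cdot\|_F$ is the Frobenius norm; $M\preceq 0$ means that $M$ is negative semidefinite. For a Hermitian matrix $A$ with eigenvalue decomposition $A=V_+\Lambda_+V_+^T+V_-\Lambda_-V_-^T$, where $[V_+\ V_-]$ is orthogonal (unitary) and the diagonal matrices $\Lambda_+$, $\Lambda_-$ contain the positive and the non-positive eigenvalues respectively, define $\Pi_+(A):=V_+\Lambda_+V_+^T$ (the projection onto the positive semidefinite cone). *)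

theory Defs
  imports "HOL-Analysis.Analysis" "Jordan_Normal_Form.Schur_Decomposition"
    "Jordan_Normal_Form.Matrix_Kernel" "Jordan_Normal_Form.VS_Connect"
begin

text \<open>
  All notions are polymorphic in the scalar type, so that they can be used both at
  \<^typ>\<open>real\<close> (where \<^const>\<open>conjugate\<close> is the identity, hence \<^const>\<open>mat_adjoint\<close>
  is the transpose) and at \<^typ>\<open>complex\<close>. The order on \<^typ>\<open>complex\<close> is the one of
  \<^theory>\<open>HOL-Library.Complex_Order\<close>: \<open>0 \<le> z\<close>, \<open>0 < z\<close> and \<open>z \<le> 0\<close> each entail that
  \<open>z\<close> is real.
\<close>

definition hermitian_mat :: "'a::conjugatable_field mat \<Rightarrow> bool" where
  "hermitian_mat A \<longleftrightarrow> square_mat A \<and> mat_adjoint A = A"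

definition psd_mat :: "'a::conjugatable_ordered_field mat \<Rightarrow> bool" where
  "psd_mat A \<longleftrightarrow> hermitian_mat A \<and> (\<forall>v\<in>carrier_vec (dim_row A). 0 \<le> (A *\<^sub>v v) \<bullet>c v)"

definition nsd_mat :: "'a::conjugatable_ordered_field mat \<Rightarrow> bool" where
  "nsd_mat A \<longleftrightarrow> hermitian_mat A \<and> (\<forall>v\<in>carrier_vec (dim_row A). (A *\<^sub>v v) \<bullet>c v \<le> 0)"

definition orthonormal_cols :: "'a::conjugatable_field mat \<Rightarrow> bool" where
  "orthonormal_cols V \<longleftrightarrow>
     (\<forall>i<dim_col V. \<forall>j<dim_col V. col V i \<bullet>c col V j = (if i = j then 1 else 0))"

definition unitary_mat :: "'a::conjugatable_field mat \<Rightarrow> bool" where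
  "unitary_mat U \<longleftrightarrow> square_mat U \<and> orthonormal_cols U"

definition frobenius_norm :: "'a::real_normed_field mat \<Rightarrow> real" where
  "frobenius_norm A = sqrt (\<Sum>i<dim_row A. \<Sum>j<dim_col A. (norm (A $$ (i, j)))\<^sup>2)"

text \<open>
  \<open>is_eig_decomp A Vp Lp Vm Lm\<close>: \<open>A = V\<^sub>+ \<Lambda>\<^sub>+ V\<^sub>+\<^sup>* + V\<^sub>- \<Lambda>\<^sub>- V\<^sub>-\<^sup>*\<close> is an eigenvalue
  decomposition. The block matrix with two blocks of zero rows at the bottom is the
  horizontal concatenation \<open>[V\<^sub>+ V\<^sub>-]\<close>; since it is required to be square, the numbers
  of columns of \<open>V\<^sub>+\<close> and \<open>V\<^sub>-\<close> (either of which may be 0) add up to the size of \<open>A\<close>.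
\<close>

definition is_eig_decomp ::
  "'a::conjugatable_ordered_field mat \<Rightarrow> 'a mat \<Rightarrow> 'a mat \<Rightarrow> 'a mat \<Rightarrow> 'a mat \<Rightarrow> bool" where
  "is_eig_decomp A Vp Lp Vm Lm \<longleftrightarrow>
     (\<exists>p q. Vp \<in> carrier_mat (dim_row A) p \<and> Lp \<in> carrier_mat p p \<and>
            Vm \<in> carrier_mat (dim_row A) q \<and> Lm \<in> carrier_mat q q \<and>
            unitary_mat (four_block_mat Vp Vm (0\<^sub>m 0 p) (0\<^sub>m 0 q)) \<and>
            diagonal_mat Lp \<and> (\<forall>i<p. 0 < Lp $$ (i, i)) \<and>
            diagonal_mat Lm \<and> (\<forall>i<q. Lm $$ (i, i) \<le> 0) \<and>
            A = Vp * Lp * mat_adjoint Vp + Vm * Lm * mat_adjoint Vm)"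

text \<open>
  For real symmetric and for complex Hermitian \<open>A\<close> an eigenvalue decomposition exists and
  \<open>V\<^sub>+ \<Lambda>\<^sub>+ V\<^sub>+\<^sup>*\<close> does not depend on its choice. (For other \<open>A\<close> the value is unspecified.)
\<close>

definition Pi_plus :: "'a::conjugatable_ordered_field mat \<Rightarrow> 'a mat" where
  "Pi_plus A = (THE P. \<exists>Vp Lp Vm Lm. is_eig_decomp A Vp Lp Vm Lm \<and> P = Vp * Lp * mat_adjoint Vp)"

end

theory Submission
  imports Defs
begin

text \<open>
  Put \<open>P = V L V\<^sup>*\<close>, \<open>Q = - W (W\<^sup>*AW) W\<^sup>*\<close> and \<open>B = P - Q\<close>. Both \<open>P\<close> and \<open>Q\<close> are positive
  semidefinite and \<open>P Q = 0\<close>, so \<open>P\<close> is the positive part of \<open>B\<close>. Since \<open>V V\<^sup>* + W W\<^sup>* = 1\<close>,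
  \<open>A - B = S + S\<^sup>*\<close> with \<open>S = R V\<^sup>*\<close>, and \<open>S S = 0\<close> because \<open>V\<^sup>*R = 0\<close>; hence
  \<open>\<parallel>A - B\<parallel>\<^sup>2 = 2 \<parallel>R\<parallel>\<^sup>2\<close>. The claim follows because taking the positive part is nonexpansive in
  the Frobenius norm; the same inequality with \<open>B = A\<close> shows that the positive part does not depend
  on the eigendecomposition.
\<close>

subsection \<open>Adjoints, block matrices and traces\<close>

text \<open>With the complementary projections \<open>H = V V\<^sup>*\<close> and
  \<open>K = W W\<^sup>*\<close>, the matrix \<open>B\<close> is the block-diagonal part of
  \<open>A\<close>, and \<open>S = K A H\<close> is one of the two off-diagonal blocks. The factor 2
  counts these two blocks, which are adjoint to each other and so have equal norm. Nonexpansiveness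
  is obtained without relating the eigenvectors of \<open>A\<close> to those of \<open>B\<close>:
  once squared norms are written as traces, the mixed terms reduce to traces of products of two
  semidefinite matrices, whose sign is known. \<open>Pi_plus\<close> is a \<open>THE\<close> term,
  so its value is accessible only after an eigendecomposition has been constructed; this is why a
  spectral theorem has to be proved. Real and complex scalars share one argument through a locale
  relating conjugation, order and norm.\<close>

lemma conjugate_diff: "conjugate (a - b) = conjugate a - conjugate (b::'a::conjugatable_ring)"
  by (metis conjugate_dist_add conjugate_neg diff_conv_add_uminus)

lemma dim_mat_adjoint [simp]:
  "dim_row (mat_adjoint A) = dim_col A" "dim_col (mat_adjoint A) = dim_row A"
  by (simp_all add: mat_adjoint_def)

lemma mat_adjoint_carrier [simp, intro]:
  "A \<in> carrier_mat n m \<Longrightarrow> mat_adjoint A \<in> carrier_mat m n"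
  by (intro carrier_matI) simp_all

lemma index_mat_adjoint [simp]:
  "i < dim_col A \<Longrightarrow> j < dim_row A \<Longrightarrow> mat_adjoint A $$ (i, j) = conjugate (A $$ (j, i))"
  by (simp add: mat_adjoint_def mat_of_rows_def)

lemma mat_adjoint_adjoint [simp]: "mat_adjoint (mat_adjoint A) = A"
  by (rule eq_matI) auto

lemma mat_adjoint_add:
  "A \<in> carrier_mat n m \<Longrightarrow> B \<in> carrier_mat n m \<Longrightarrow>
    mat_adjoint (A + B) = mat_adjoint A + mat_adjoint B"
  by (rule eq_matI) (auto simp: conjugate_dist_add)

lemma mat_adjoint_minus:
  "A \<in> carrier_mat n m \<Longrightarrow> B \<in> carrier_mat n m \<Longrightarrow>
    mat_adjoint (A - B) = mat_adjoint A - mat_adjoint B"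
  by (rule eq_matI) (auto simp: conjugate_diff)

lemma mat_adjoint_uminus: "mat_adjoint (- A) = - mat_adjoint A"
  by (rule eq_matI) (auto simp: conjugate_neg)

lemma mat_adjoint_mult:
  assumes "dim_col A = dim_row B"
  shows "mat_adjoint (A * B) = mat_adjoint B * mat_adjoint A"
proof (rule eq_matI)
  fix i j assume "i < dim_row (mat_adjoint B * mat_adjoint A)" "j < dim_col (mat_adjoint B * mat_adjoint A)"
  then show "mat_adjoint (A * B) $$ (i, j) = (mat_adjoint B * mat_adjoint A) $$ (i, j)"
    using assms
    by (auto simp: scalar_prod_def sum_conjugate conjugate_dist_mul intro!: sum.cong mult.commute)
qed simp_all

lemma mat_adjoint_diagonal_mat:
  assumes "D \<in> carrier_mat r r" "diagonal_mat D"
    and "\<And>i. i < r \<Longrightarrow> conjugate (D $$ (i, i)) = D $$ (i, i)"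
  shows "mat_adjoint D = D"
proof (rule eq_matI)
  fix i j assume "i < dim_row D" "j < dim_col D"
  then show "mat_adjoint D $$ (i, j) = D $$ (i, j)"
    using assms by (cases "i = j") (auto simp: diagonal_mat_def)
qed (use assms in auto)

text \<open>Dimension equations serve as side conditions because the simplifier can compute them for
  nested products, with no inner dimensions to guess.\<close>

lemma assoc_mult_mat_dim:
  assumes "dim_col A = dim_row B" "dim_col B = dim_row C"
  shows "(A * B) * C = A * (B * C)"
proof (rule assoc_mult_mat)
  show "A \<in> carrier_mat (dim_row A) (dim_row B)" "B \<in> carrier_mat (dim_row B) (dim_row C)"
    "C \<in> carrier_mat (dim_row C) (dim_col C)"
    using assms by (auto intro: carrier_matI)
qed

lemma cscalar_prod_sum: "v \<bullet>c w = (\<Sum>i<dim_vec w. v $ i * conjugate (w $ i))"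
  by (simp add: scalar_prod_def atLeast0LessThan)

lemma cscalar_prod_adjoint:
  assumes "A \<in> carrier_mat n m" "x \<in> carrier_vec m" "y \<in> carrier_vec n"
  shows "(A *\<^sub>v x) \<bullet>c y = x \<bullet>c (mat_adjoint A *\<^sub>v y)"
proof -
  have "(A *\<^sub>v x) \<bullet>c y = (\<Sum>i<n. \<Sum>j<m. A $$ (i, j) * x $ j * conjugate (y $ i))"
    using assms by (simp add: scalar_prod_def atLeast0LessThan sum_distrib_right)
  also have "\<dots> = (\<Sum>j<m. \<Sum>i<n. A $$ (i, j) * x $ j * conjugate (y $ i))"
    by (rule sum.swap)
  also have "\<dots> = x \<bullet>c (mat_adjoint A *\<^sub>v y)"
    using assms by (simp add: scalar_prod_def atLeast0LessThan sum_distrib_left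
        sum_conjugate conjugate_dist_mul mult_ac)
  finally show ?thesis .
qed

text \<open>\<open>\<bullet>c\<close> conjugates its second argument, and the adjoint conjugates the
  entries of \<open>V\<close>; hence the column of \<open>V\<close> stands second.\<close>

lemma index_adjoint_mult:
  assumes "V \<in> carrier_mat n k" "W \<in> carrier_mat n m" "i < k" "j < m"
  shows "(mat_adjoint V * W) $$ (i, j) = col W j \<bullet>c col V i"
  using assms by (simp add: scalar_prod_def mult.commute)

lemma orthonormal_cols_iff:
  assumes V: "V \<in> carrier_mat n k"
  shows "orthonormal_cols V \<longleftrightarrow> mat_adjoint V * V = 1\<^sub>m k"
proof
  assume o: "orthonormal_cols V"
  show "mat_adjoint V * V = 1\<^sub>m k"
    using V o
    by (intro eq_matI) (auto simp: index_adjoint_mult[OF V V] orthonormal_cols_def simp del: index_mult_mat(1))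
next
  assume eq: "mat_adjoint V * V = 1\<^sub>m k"
  show "orthonormal_cols V"
    unfolding orthonormal_cols_def
  proof (intro allI impI)
    fix i j assume "i < dim_col V" "j < dim_col V"
    with V show "col V i \<bullet>c col V j = (if i = j then 1 else 0)"
      using index_adjoint_mult[OF V V, of j i] eq by auto
  qed
qed

section \<open>Horizontal concatenations encoded with empty lower blocks, and their
  unitarity\<close>

lemma adjoint_block_cols:
  assumes V: "V \<in> carrier_mat n k" and W: "W \<in> carrier_mat n m"
  shows "mat_adjoint (four_block_mat V W (0\<^sub>m 0 k) (0\<^sub>m 0 m))
    = four_block_mat (mat_adjoint V) (0\<^sub>m k 0) (mat_adjoint W) (0\<^sub>m m 0)"
  using assms by (intro eq_matI) auto

lemma adjoint_block_cols_mult: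
  fixes V W :: "'a::conjugatable_field mat"
  assumes V: "V \<in> carrier_mat n k" and W: "W \<in> carrier_mat n m"
  defines "U \<equiv> four_block_mat V W (0\<^sub>m 0 k) (0\<^sub>m 0 m)"
  shows "mat_adjoint U * U = four_block_mat (mat_adjoint V * V) (mat_adjoint V * W)
    (mat_adjoint W * V) (mat_adjoint W * W)"
    and "U * mat_adjoint U = V * mat_adjoint V + W * mat_adjoint W"
proof -
  \<comment> \<open>The empty blocks meet in products with inner dimension 0. These are zero
    matrices of full size, so they disappear from each block.\<close>
  have zero: "M + 0\<^sub>m r c = M" if "dim_row M = r" "dim_col M = c" for M :: "'a mat" and r c
    using that by (intro eq_matI) auto
  have "mat_adjoint U * U = four_block_mat (mat_adjoint V * V + 0\<^sub>m k 0 * 0\<^sub>m 0 k)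
      (mat_adjoint V * W + 0\<^sub>m k 0 * 0\<^sub>m 0 m)
    (mat_adjoint W * V + 0\<^sub>m m 0 * 0\<^sub>m 0 k) (mat_adjoint W * W + 0\<^sub>m m 0 * 0\<^sub>m 0 m)"
    unfolding adjoint_block_cols[OF V W] U_def
    by (rule mult_four_block_mat) (use V W in auto)
  then show "mat_adjoint U * U = four_block_mat (mat_adjoint V * V) (mat_adjoint V * W)
    (mat_adjoint W * V) (mat_adjoint W * W)"
    using V W by (simp add: zero)
  have "U * mat_adjoint U = four_block_mat (V * mat_adjoint V + W * mat_adjoint W)
      (V * 0\<^sub>m k 0 + W * 0\<^sub>m m 0) (0\<^sub>m 0 k * mat_adjoint V + 0\<^sub>m 0 m * mat_adjoint W)
      (0\<^sub>m 0 k * 0\<^sub>m k 0 + 0\<^sub>m 0 m * 0\<^sub>m m 0)"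
    unfolding adjoint_block_cols[OF V W] U_def
    by (rule mult_four_block_mat) (use V W in auto)
  then show "U * mat_adjoint U = V * mat_adjoint V + W * mat_adjoint W"
    by (intro eq_matI) (use V W in auto)
qed

lemma four_block_mat_inject:
  assumes "A \<in> carrier_mat k l" "A' \<in> carrier_mat k l" "D \<in> carrier_mat m p" "D' \<in> carrier_mat m p"
    "B \<in> carrier_mat k p" "B' \<in> carrier_mat k p" "C \<in> carrier_mat m l" "C' \<in> carrier_mat m l"
    and eq: "four_block_mat A B C D = four_block_mat A' B' C' D'"
  shows "A = A'" "B = B'" "C = C'" "D = D'"
proof -
  note ix = arg_cong[OF eq, of "\<lambda>M. M $$ (i, j)" for i j]
  show "A = A'"
  proof (rule eq_matI)
    fix i j assume "i < dim_row A'" "j < dim_col A'"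
    then show "A $$ (i, j) = A' $$ (i, j)" using assms(1-8) ix[of i j] by simp
  qed (use assms in auto)
  show "B = B'"
  proof (rule eq_matI)
    fix i j assume "i < dim_row B'" "j < dim_col B'"
    then show "B $$ (i, j) = B' $$ (i, j)" using assms(1-8) ix[of i "l + j"] by simp
  qed (use assms in auto)
  show "C = C'"
  proof (rule eq_matI)
    fix i j assume "i < dim_row C'" "j < dim_col C'"
    then show "C $$ (i, j) = C' $$ (i, j)" using assms(1-8) ix[of "k + i" j] by simp
  qed (use assms in auto)
  show "D = D'"
  proof (rule eq_matI)
    fix i j assume "i < dim_row D'" "j < dim_col D'"
    then show "D $$ (i, j) = D' $$ (i, j)" using assms(1-8) ix[of "k + i" "l + j"] by simp
  qed (use assms in auto)
qed

text \<open>Orthonormality says that the Gram matrix is the identity, and this can be compared block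
  by block; \<open>n = k + m\<close> is the squareness of the concatenation.\<close>

lemma unitary_block_cols_iff:
  assumes V: "V \<in> carrier_mat n k" and W: "W \<in> carrier_mat n m"
  shows "unitary_mat (four_block_mat V W (0\<^sub>m 0 k) (0\<^sub>m 0 m)) \<longleftrightarrow>
    n = k + m \<and> mat_adjoint V * V = 1\<^sub>m k \<and> mat_adjoint V * W = 0\<^sub>m k m \<and>
    mat_adjoint W * V = 0\<^sub>m m k \<and> mat_adjoint W * W = 1\<^sub>m m" (is "unitary_mat ?U \<longleftrightarrow> ?R")
proof -
  have U: "?U \<in> carrier_mat n (k + m)" using V W by auto
  show ?thesis
  proof
    assume u: "unitary_mat ?U"
    have "four_block_mat (mat_adjoint V * V) (mat_adjoint V * W) (mat_adjoint W * V) (mat_adjoint W * W)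
      = four_block_mat (1\<^sub>m k) (0\<^sub>m k m) (0\<^sub>m m k) (1\<^sub>m m)"
      using u unfolding unitary_mat_def orthonormal_cols_iff[OF U] adjoint_block_cols_mult[OF V W] by simp
    note inj = four_block_mat_inject[OF _ _ _ _ _ _ _ _ this, of k k m m]
    have "mat_adjoint V * V = 1\<^sub>m k" "mat_adjoint V * W = 0\<^sub>m k m"
      "mat_adjoint W * V = 0\<^sub>m m k" "mat_adjoint W * W = 1\<^sub>m m"
      by (rule inj; use V W in auto)+
    then show ?R
      using V W u by (auto simp: unitary_mat_def)
  next
    assume ?R
    then show "unitary_mat ?U"
      unfolding unitary_mat_def orthonormal_cols_iff[OF U] adjoint_block_cols_mult[OF V W]
      using V W by simp
  qed
qed

text \<open>A left inverse of a square matrix is also a right inverse, so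
  \<open>U\<^sup>* U = 1\<close> turns into \<open>U U\<^sup>* = 1\<close>, whose block form is this
  resolution of the identity.\<close>

lemma unitary_block_cols_complete:
  fixes V W :: "'a::conjugatable_field mat"
  assumes V: "V \<in> carrier_mat n k" and W: "W \<in> carrier_mat n m"
    and u: "unitary_mat (four_block_mat V W (0\<^sub>m 0 k) (0\<^sub>m 0 m))"
  shows "V * mat_adjoint V + W * mat_adjoint W = 1\<^sub>m n"
proof -
  let ?U = "four_block_mat V W (0\<^sub>m 0 k) (0\<^sub>m 0 m)"
  have n: "n = k + m" using u unitary_block_cols_iff[OF V W] by simp
  have U: "?U \<in> carrier_mat n n"
    by (rule carrier_matI) (use V W n in simp_all)
  have "mat_adjoint ?U * ?U = 1\<^sub>m n" using u orthonormal_cols_iff[OF U] by (simp add: unitary_mat_def)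
  then have "?U * mat_adjoint ?U = 1\<^sub>m n"
    by (rule mat_mult_left_right_inverse[OF mat_adjoint_carrier[OF U] U])
  then show ?thesis unfolding adjoint_block_cols_mult[OF V W] .
qed

section \<open>Traces\<close>

definition trace_mat :: "'a::comm_monoid_add mat \<Rightarrow> 'a" where
  "trace_mat A = (\<Sum>i<dim_row A. A $$ (i, i))"

lemma trace_mat_add:
  "A \<in> carrier_mat n n \<Longrightarrow> B \<in> carrier_mat n n \<Longrightarrow> trace_mat (A + B) = trace_mat A + trace_mat B"
  by (simp add: trace_mat_def sum.distrib)

lemma trace_mat_minus:
  fixes A B :: "'a::ab_group_add mat"
  shows "A \<in> carrier_mat n n \<Longrightarrow> B \<in> carrier_mat n n \<Longrightarrow> trace_mat (A - B) = trace_mat A - trace_mat B"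
  by (simp add: trace_mat_def sum_subtractf)

lemma trace_mat_comm:
  fixes A B :: "'a::comm_ring mat"
  assumes "A \<in> carrier_mat n m" "B \<in> carrier_mat m n"
  shows "trace_mat (A * B) = trace_mat (B * A)"
proof -
  have "trace_mat (A * B) = (\<Sum>i<n. \<Sum>j<m. A $$ (i, j) * B $$ (j, i))"
    using assms by (simp add: trace_mat_def scalar_prod_def atLeast0LessThan)
  also have "\<dots> = (\<Sum>j<m. \<Sum>i<n. A $$ (i, j) * B $$ (j, i))"
    by (rule sum.swap)
  also have "\<dots> = trace_mat (B * A)"
    using assms by (simp add: trace_mat_def scalar_prod_def atLeast0LessThan mult.commute)
  finally show ?thesis .
qed

section \<open>Inner products, orthonormal families and orthogonal vectors\<close>

lemma cscalar_prod_commute: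
  assumes "u \<in> carrier_vec n" "w \<in> carrier_vec n"
  shows "w \<bullet>c u = conjugate (u \<bullet>c (w :: 'a::conjugatable_field vec))"
  using assms by (simp add: cscalar_prod_sum sum_conjugate conjugate_dist_mul mult.commute)

lemma cscalar_prod_smult:
  fixes u w :: "'a::conjugatable_field vec"
  assumes "u \<in> carrier_vec n" "w \<in> carrier_vec n"
  shows "(a \<cdot>\<^sub>v u) \<bullet>c w = a * (u \<bullet>c w)" "u \<bullet>c (a \<cdot>\<^sub>v w) = conjugate a * (u \<bullet>c w)"
  using assms by (simp_all add: cscalar_prod_sum sum_distrib_left conjugate_dist_mul mult_ac)

text \<open>Moving \<open>A\<close> across the inner product of \<open>A v\<close> with
  \<open>v\<close> produces \<open>e\<close> on one side and \<open>conjugate e\<close> on the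
  other; the nonzero factor \<open>v \<bullet>c v\<close> cancels.\<close>

lemma hermitian_eigenvalue_conjugate:
  fixes A :: "'a::conjugatable_ordered_field mat"
  assumes A: "A \<in> carrier_mat n n" and herm: "hermitian_mat A"
    and v: "v \<in> carrier_vec n" "v \<noteq> 0\<^sub>v n" and eig: "A *\<^sub>v v = e \<cdot>\<^sub>v v"
  shows "conjugate e = e"
proof -
  have "e * (v \<bullet>c v) = conjugate e * (v \<bullet>c v)"
    using cscalar_prod_adjoint[OF A v(1) v(1)] herm cscalar_prod_smult[OF v(1) v(1), of e]
    by (simp add: eig hermitian_mat_def)
  moreover have "v \<bullet>c v \<noteq> 0" using v conjugate_square_eq_0_vec[OF v(1)] by simp
  ultimately show ?thesis by simp
qed

text \<open>Lists feed directly into \<open>mat_of_cols\<close>; distinctness identifies equality of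
  members with equality of indices, so the condition on the set becomes one on columns.\<close>

definition orthonormal_list :: "nat \<Rightarrow> 'a::conjugatable_field vec list \<Rightarrow> bool" where
  "orthonormal_list n us \<longleftrightarrow> distinct us \<and> set us \<subseteq> carrier_vec n \<and>
    (\<forall>u\<in>set us. \<forall>w\<in>set us. u \<bullet>c w = (if u = w then 1 else 0))"

lemma orthonormal_list_filter: "orthonormal_list n us \<Longrightarrow> orthonormal_list n (filter P us)"
  by (auto simp: orthonormal_list_def)

lemma orthonormal_list_snoc:
  assumes us: "orthonormal_list n us" and u: "u \<in> carrier_vec n" "u \<bullet>c u = 1"
    and orth: "\<forall>w\<in>set us. u \<bullet>c w = 0"
  shows "orthonormal_list n (us @ [u])"
proof -
  have "u \<notin> set us" using u orth by auto
  moreover have "w \<bullet>c u = 0" if "w \<in> set us" for w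
    using cscalar_prod_commute[OF u(1), of w] orth us that by (auto simp: orthonormal_list_def)
  ultimately show ?thesis using us u orth by (auto simp: orthonormal_list_def)
qed

lemma adjoint_mult_orthonormal_lists:
  assumes us: "set us \<subseteq> carrier_vec n" and ws: "set ws \<subseteq> carrier_vec n"
    and orth: "\<forall>u\<in>set us. \<forall>w\<in>set ws. w \<bullet>c u = 0"
  shows "mat_adjoint (mat_of_cols n us) * mat_of_cols n ws = 0\<^sub>m (length us) (length ws)"
proof (rule eq_matI)
  fix i j assume "i < dim_row (0\<^sub>m (length us) (length ws) :: 'a mat)"
    "j < dim_col (0\<^sub>m (length us) (length ws) :: 'a mat)"
  then have ij: "i < length us" "j < length ws" by simp_all
  then have "us ! i \<in> carrier_vec n" "ws ! j \<in> carrier_vec n" using us ws by auto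
  then have "(mat_adjoint (mat_of_cols n us) * mat_of_cols n ws) $$ (i, j) = ws ! j \<bullet>c us ! i"
    using index_adjoint_mult[OF mat_of_cols_carrier(1)[of n us] mat_of_cols_carrier(1)[of n ws] ij] ij
    by (simp del: index_mult_mat(1))
  then show "(mat_adjoint (mat_of_cols n us) * mat_of_cols n ws) $$ (i, j)
      = 0\<^sub>m (length us) (length ws) $$ (i, j)"
    using orth ij by simp
qed simp_all

lemma adjoint_mult_orthonormal_list:
  assumes "orthonormal_list n us"
  shows "mat_adjoint (mat_of_cols n us) * mat_of_cols n us = 1\<^sub>m (length us)"
proof -
  have c: "col (mat_of_cols n us) i = us ! i" if "i < length us" for i
    using assms that by (intro col_mat_of_cols) (auto simp: orthonormal_list_def)
  have "orthonormal_cols (mat_of_cols n us)"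
    using assms unfolding orthonormal_cols_def orthonormal_list_def
    by (simp add: c nth_eq_iff_index_eq)
  then show ?thesis by (simp add: orthonormal_cols_iff[OF mat_of_cols_carrier(1)])
qed

lemma unitary_block_orthonormal_lists:
  assumes us: "orthonormal_list n us" and ws: "orthonormal_list n ws"
    and orth: "\<forall>u\<in>set us. \<forall>w\<in>set ws. u \<bullet>c w = 0 \<and> w \<bullet>c u = 0"
    and len: "length us + length ws = n"
  shows "unitary_mat (four_block_mat (mat_of_cols n us) (mat_of_cols n ws)
    (0\<^sub>m 0 (length us)) (0\<^sub>m 0 (length ws)))"
  using us ws orth len adjoint_mult_orthonormal_lists[of us n ws] adjoint_mult_orthonormal_lists[of ws n us]
  by (subst unitary_block_cols_iff[OF mat_of_cols_carrier(1) mat_of_cols_carrier(1)])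
    (simp add: adjoint_mult_orthonormal_list orthonormal_list_def)

text \<open>Orthogonality to all of \<open>us\<close> is a homogeneous linear system with fewer than
  \<open>n\<close> equations. Padding it with zero rows gives a square singular matrix, to which the
  determinant criterion for a nontrivial kernel applies.\<close>

lemma exists_orthogonal_vec:
  fixes us :: "'a::conjugatable_field vec list"
  assumes us: "set us \<subseteq> carrier_vec n" and len: "length us < n"
  obtains v where "v \<in> carrier_vec n" "v \<noteq> 0\<^sub>v n" "\<forall>u\<in>set us. v \<bullet>c u = 0"
proof -
  define M where "M = mat n n (\<lambda>(i, j). if i < length us then conjugate (us ! i $ j) else 0)"
  have M: "M \<in> carrier_mat n n" by (simp add: M_def)
  \<comment> \<open>Since \<open>length us < n\<close>, at least the last row of \<open>M\<close> is
    padding.\<close>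
  have "transpose_mat M *\<^sub>v unit_vec n (n - 1) = 0\<^sub>v n"
  proof (rule eq_vecI)
    fix i assume "i < dim_vec (0\<^sub>v n :: 'a vec)"
    then show "(transpose_mat M *\<^sub>v unit_vec n (n - 1)) $ i = 0\<^sub>v n $ i"
      using len M scalar_prod_right_unit[of "n - 1" n "col M i"] by (simp add: M_def)
  qed (simp add: M_def)
  moreover have "unit_vec n (n - 1) \<noteq> (0\<^sub>v n :: 'a vec)" using len by (intro unit_vec_nonzero) simp
  ultimately have "det (transpose_mat M) = 0"
    using det_0_iff_vec_prod_zero_field[OF transpose_carrier_mat[THEN iffD2, OF M]]
      unit_vec_carrier[of n "n - 1"] by blast
  then have "det M = 0" by (simp add: det_transpose[OF M])
  then obtain v where v: "v \<in> carrier_vec n" "v \<noteq> 0\<^sub>v n" "M *\<^sub>v v = 0\<^sub>v n"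
    using det_0_iff_vec_prod_zero_field[OF M] by blast
  have "v \<bullet>c u = 0" if "u \<in> set us" for u
  proof -
    obtain i where i: "i < length us" "u = us ! i" using \<open>u \<in> set us\<close> by (auto simp: in_set_conv_nth)
    then have u: "u \<in> carrier_vec n" using us by auto
    have "(M *\<^sub>v v) $ i = v \<bullet>c u"
      using i len v(1) u by (simp add: M_def cscalar_prod_sum scalar_prod_def atLeast0LessThan mult.commute)
    then show ?thesis unfolding v(3) using i len by simp
  qed
  with v show ?thesis using that by blast
qed

lemma mult_mat_unit_vec:
  fixes A :: "'a::semiring_1 mat"
  assumes "A \<in> carrier_mat n m" "j < m"
  shows "A *\<^sub>v unit_vec m j = col A j"
proof (rule eq_vecI)
  fix i assume "i < dim_vec (col A j)"
  then show "(A *\<^sub>v unit_vec m j) $ i = col A j $ i"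
    using assms scalar_prod_right_unit[of j m "row A i"] by simp
qed (use assms in simp)

lemma frobenius_norm_eq_0:
  assumes "frobenius_norm A = 0"
  shows "A = 0\<^sub>m (dim_row A) (dim_col A)"
proof (rule eq_matI)
  fix i j assume "i < dim_row (0\<^sub>m (dim_row A) (dim_col A))" "j < dim_col (0\<^sub>m (dim_row A) (dim_col A))"
  moreover from assms have "\<forall>i<dim_row A. \<forall>j<dim_col A. (norm (A $$ (i, j)))\<^sup>2 = 0"
    by (simp add: frobenius_norm_def sum_nonneg_eq_0_iff sum_nonneg)
  ultimately show "A $$ (i, j) = 0\<^sub>m (dim_row A) (dim_col A) $$ (i, j)" by simp
qed simp_all

text \<open>The quadratic form of the product at \<open>x\<close> is that of \<open>L\<close> at
  \<open>V\<^sup>* x\<close>.\<close>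

lemma psd_mat_congruence:
  assumes L: "L \<in> carrier_mat k k" "psd_mat L" and V: "V \<in> carrier_mat n k"
  shows "psd_mat (V * L * mat_adjoint V)"
proof -
  have "mat_adjoint (V * L * mat_adjoint V) = V * L * mat_adjoint V"
    using L V by (simp add: mat_adjoint_mult assoc_mult_mat_dim psd_mat_def hermitian_mat_def)
  moreover have "0 \<le> ((V * L * mat_adjoint V) *\<^sub>v x) \<bullet>c x" if x: "x \<in> carrier_vec n" for x
  proof -
    let ?y = "mat_adjoint V *\<^sub>v x"
    have y: "?y \<in> carrier_vec k" using V x by (intro mult_mat_vec_carrier) auto
    have Ly: "L *\<^sub>v ?y \<in> carrier_vec k" using L(1) y by (rule mult_mat_vec_carrier)
    have "(V * L * mat_adjoint V) *\<^sub>v x = V * L *\<^sub>v ?y"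
      using mult_carrier_mat[OF V L(1)] mat_adjoint_carrier[OF V] x by (rule assoc_mult_mat_vec)
    also have "\<dots> = V *\<^sub>v (L *\<^sub>v ?y)"
      using V L(1) y by (rule assoc_mult_mat_vec)
    finally have "((V * L * mat_adjoint V) *\<^sub>v x) \<bullet>c x = (L *\<^sub>v ?y) \<bullet>c ?y"
      using cscalar_prod_adjoint[OF V Ly x] by simp
    then show ?thesis using L y by (simp add: psd_mat_def)
  qed
  ultimately show ?thesis using V by (simp add: psd_mat_def hermitian_mat_def)
qed

lemma is_eig_decompE:
  assumes "is_eig_decomp A Vp Lp Vm Lm" and A: "A \<in> carrier_mat n n"
  obtains p q where
    "Vp \<in> carrier_mat n p" "Vm \<in> carrier_mat n q" "Lp \<in> carrier_mat p p" "Lm \<in> carrier_mat q q"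
    "unitary_mat (four_block_mat Vp Vm (0\<^sub>m 0 p) (0\<^sub>m 0 q))"
    "diagonal_mat Lp" "\<forall>i<p. 0 < Lp $$ (i, i)"
    "diagonal_mat Lm" "\<forall>i<q. Lm $$ (i, i) \<le> 0"
    "A = Vp * Lp * mat_adjoint Vp + Vm * Lm * mat_adjoint Vm"
proof -
  have n: "dim_row A = n" using A by (rule carrier_matD)
  show thesis
    using assms(1) unfolding is_eig_decomp_def n
    by (elim exE conjE) (rule that)
qed

subsection \<open>Positive semidefinite matrices over the real or complex numbers\<close>

text \<open>The type parameter only fixes the scalars. Conjugation and norm come from separate
  classes and are tied together by the first assumption; the second makes nonnegative scalars
  self-conjugate; the third isolates the point where the real and the complex proof differ.\<close>

locale hermitian_scalars =
  fixes scalar_type :: "'a::{conjugatable_ordered_field, real_normed_field} itself"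
  assumes mult_conjugate: "\<And>a::'a. a * conjugate a = of_real ((norm a)\<^sup>2)"
    and nonneg_conjugate: "\<And>a::'a. 0 \<le> a \<Longrightarrow> conjugate a = a"
    and hermitian_eigenvalue: "\<And>n (A::'a mat). A \<in> carrier_mat n n \<Longrightarrow> hermitian_mat A \<Longrightarrow>
      0 < n \<Longrightarrow> \<exists>e. eigenvalue A e"
begin

section \<open>The scalar order on the embedded real numbers\<close>

lemma conjugate_of_real: "conjugate (of_real x :: 'a) = of_real x"
proof (cases "x = 0")
  case False
  have "(of_real x :: 'a) * conjugate (of_real x) = of_real x * of_real x"
    using mult_conjugate[of "of_real x"] by (simp add: power2_eq_square)
  then show ?thesis using False by simp
qed simp

text \<open>Write \<open>x\<close> as \<open>sqrt x\<close> times its own conjugate; such products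
  are nonnegative in the class.\<close>

lemma of_real_nonneg: "0 \<le> x \<Longrightarrow> (0::'a) \<le> of_real x"
  using conjugate_square_positive[of "of_real (sqrt x) :: 'a"]
  by (simp add: conjugate_of_real flip: of_real_mult)

text \<open>For self-conjugate \<open>a\<close> the norm identity reads
  \<open>a * a = (norm a)\<^sup>2\<close>, which factorises and leaves \<open>a\<close> equal to
  plus or minus its norm.\<close>

lemma self_conjugate_of_real:
  assumes "conjugate a = (a::'a)"
  obtains x where "a = of_real x"
proof -
  have "(a - of_real (norm a)) * (a + of_real (norm a)) = 0"
    using mult_conjugate[of a] assms by (simp add: algebra_simps power2_eq_square)
  then have "a = of_real (norm a) \<or> a = of_real (- norm a)"
    by (auto simp: eq_neg_iff_add_eq_0)
  then show ?thesis using that by blast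
qed

lemma of_real_nonneg_iff [simp]: "(0::'a) \<le> of_real x \<longleftrightarrow> 0 \<le> x"
proof
  assume "(0::'a) \<le> of_real x"
  show "0 \<le> x"
  proof (rule ccontr)
    assume x: "\<not> 0 \<le> x"
    have "(0::'a) \<le> of_real (- x)" by (rule of_real_nonneg) (use x in simp)
    then have "of_real x + 0 \<le> of_real x + (of_real (- x) :: 'a)" by (rule add_left_mono)
    then have "of_real x = (0::'a)" using \<open>0 \<le> of_real x\<close> by (simp add: order.antisym)
    then show False using x by simp
  qed
qed (rule of_real_nonneg)

lemma nonneg_of_real:
  assumes "0 \<le> (a::'a)"
  obtains x where "a = of_real x" "0 \<le> x"
  using self_conjugate_of_real[OF nonneg_conjugate[OF assms]] assms that by (metis of_real_nonneg_iff)

lemma nonneg_mult: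
  assumes "0 \<le> (a::'a)" "0 \<le> b"
  shows "0 \<le> a * b"
proof -
  from assms obtain x y where "a = of_real x" "b = of_real y" "0 \<le> x" "0 \<le> y"
    by (metis nonneg_of_real)
  then show ?thesis by (simp flip: of_real_mult)
qed

lemma neg_nonneg_iff: "0 \<le> - (a::'a) \<longleftrightarrow> a \<le> 0"
  using add_left_mono[of 0 "- a" a] add_left_mono[of a 0 "- a"] by auto

lemma of_real_le_iff: "(of_real x :: 'a) \<le> of_real y \<longleftrightarrow> x \<le> y"
proof -
  have "(of_real x :: 'a) \<le> of_real y \<longleftrightarrow> (0::'a) \<le> of_real (y - x)"
    using add_left_mono[of "of_real x :: 'a" "of_real y" "- of_real x"]
      add_left_mono[of "0::'a" "of_real (y - x)" "of_real x"] by (auto simp: algebra_simps)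
  then show ?thesis by (simp only: of_real_nonneg_iff diff_ge_0_iff_ge)
qed

text \<open>Diagonal entry \<open>i\<close> of the product is the sum of squared norms along row
  \<open>i\<close>. This moves norm estimates into matrix algebra; the trace lives in the scalar
  field, hence the embedding \<open>of_real\<close>.\<close>

lemma frobenius_trace:
  fixes A :: "'a mat"
  shows "of_real ((frobenius_norm A)\<^sup>2) = trace_mat (A * mat_adjoint A)"
proof -
  have "(frobenius_norm A)\<^sup>2 = (\<Sum>i<dim_row A. \<Sum>j<dim_col A. (norm (A $$ (i, j)))\<^sup>2)"
    unfolding frobenius_norm_def by (intro real_sqrt_pow2 sum_nonneg) simp
  then show ?thesis
    by (simp add: trace_mat_def scalar_prod_def atLeast0LessThan mult_conjugate)
qed

lemma trace_mult_adjoint_nonneg: "0 \<le> trace_mat (A * mat_adjoint (A::'a mat))"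
  unfolding frobenius_trace[symmetric] by (simp del: of_real_power)

text \<open>Cycling \<open>V\<^sup>*\<close> to the front turns the trace into a sum over the
  columns of \<open>V\<close>: the quadratic form of \<open>X\<close> at column \<open>i\<close>
  times the weight \<open>D $$ (i, i)\<close>. No diagonalisation of \<open>X\<close> is
  involved.\<close>

lemma trace_psd_mult_nonneg:
  fixes X V D :: "'a mat"
  assumes X: "X \<in> carrier_mat n n" "psd_mat X" and V: "V \<in> carrier_mat n p"
    and D: "D \<in> carrier_mat p p" "diagonal_mat D" "\<And>i. i < p \<Longrightarrow> 0 \<le> D $$ (i, i)"
  shows "0 \<le> trace_mat (X * (V * D * mat_adjoint V))"
proof -
  let ?M = "mat_adjoint V * (X * V)"
  have XV: "X * V \<in> carrier_mat n p" using X V by (rule_tac mult_carrier_mat)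
  have M: "?M \<in> carrier_mat p p" using mat_adjoint_carrier[OF V] XV by (rule mult_carrier_mat)
  have XVD: "X * V * D \<in> carrier_mat n p" using XV D(1) by (rule mult_carrier_mat)
  have "X * (V * D * mat_adjoint V) = (X * V * D) * mat_adjoint V"
    using X V D by (simp add: assoc_mult_mat_dim)
  then have "trace_mat (X * (V * D * mat_adjoint V)) = trace_mat (mat_adjoint V * (X * V * D))"
    using trace_mat_comm[OF XVD mat_adjoint_carrier[OF V]] by simp
  also have "mat_adjoint V * (X * V * D) = ?M * D"
    using X V D by (simp add: assoc_mult_mat_dim)
  also have "trace_mat (?M * D) = (\<Sum>i<p. ?M $$ (i, i) * D $$ (i, i))"
  proof -
    have "(?M * D) $$ (i, i) = ?M $$ (i, i) * D $$ (i, i)" if i: "i < p" for i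
    proof -
      have "(?M * D) $$ (i, i) = (\<Sum>j<p. ?M $$ (i, j) * D $$ (j, i))"
        using carrier_matD[OF M] carrier_matD[OF D(1)] i
        by (subst index_mult_mat(1)) (simp_all add: scalar_prod_def atLeast0LessThan del: index_mult_mat(1))
      also have "\<dots> = (\<Sum>j<p. if j = i then ?M $$ (i, i) * D $$ (i, i) else 0)"
        using D i by (intro sum.cong) (auto simp: diagonal_mat_def)
      finally show ?thesis using i by simp
    qed
    then show ?thesis using V D by (simp add: trace_mat_def del: index_mult_mat(1))
  qed
  also have "0 \<le> \<dots>"
  proof (rule sum_nonneg)
    fix i assume "i \<in> {..<p}"
    then have i: "i < p" by simp
    have "?M $$ (i, i) = col (X * V) i \<bullet>c col V i" by (rule index_adjoint_mult[OF V XV i i])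
    also have "col (X * V) i = X *\<^sub>v col V i" by (rule col_mult2) (use X V i in auto)
    also have "0 \<le> (X *\<^sub>v col V i) \<bullet>c col V i"
      using X V i by (auto simp: psd_mat_def)
    finally show "0 \<le> ?M $$ (i, i) * D $$ (i, i)" using D(3)[OF i] by (rule nonneg_mult)
  qed
  finally show ?thesis .
qed

text \<open>
  With \<open>A = P' - Q'\<close> the Jordan splitting given by the eigendecomposition, the cross terms in
  \<open>\<parallel>(P - P') - (Q - Q')\<parallel>\<^sup>2\<close> contribute \<open>2 tr (P Q') + 2 tr (P' Q) \<ge> 0\<close>.
\<close>

lemma frobenius_psd_parts_le:
  fixes A P Q :: "'a mat"
  assumes A: "A \<in> carrier_mat n n" and dec: "is_eig_decomp A Vp Lp Vm Lm"
    and P: "P \<in> carrier_mat n n" "psd_mat P" and Q: "Q \<in> carrier_mat n n" "psd_mat Q"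
    and PQ: "P * Q = 0\<^sub>m n n"
  shows "(frobenius_norm (P - Vp * Lp * mat_adjoint Vp))\<^sup>2 \<le> (frobenius_norm (P - Q - A))\<^sup>2"
proof -
  obtain p q where
    V: "Vp \<in> carrier_mat n p" "Vm \<in> carrier_mat n q"
    and L: "Lp \<in> carrier_mat p p" "Lm \<in> carrier_mat q q"
    and u: "unitary_mat (four_block_mat Vp Vm (0\<^sub>m 0 p) (0\<^sub>m 0 q))"
    and Lp: "diagonal_mat Lp" "\<forall>i<p. 0 < Lp $$ (i, i)"
    and Lm: "diagonal_mat Lm" "\<forall>i<q. Lm $$ (i, i) \<le> 0"
    and Aeq: "A = Vp * Lp * mat_adjoint Vp + Vm * Lm * mat_adjoint Vm"
    by (rule is_eig_decompE[OF dec A]) (rule that)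
  define P' where "P' = Vp * Lp * mat_adjoint Vp"
  define N where "N = Vm * Lm * mat_adjoint Vm"
  have P': "P' \<in> carrier_mat n n" and N: "N \<in> carrier_mat n n"
    unfolding P'_def N_def by (intro carrier_matI, use V L in simp_all)+
  have conj_neg: "conjugate a = a" if "a \<le> 0" for a :: 'a
    using nonneg_conjugate[of "- a"] that by (simp add: neg_nonneg_iff conjugate_neg)
  have adjL: "mat_adjoint Lp = Lp" "mat_adjoint Lm = Lm"
    using mat_adjoint_diagonal_mat[OF L(1) Lp(1)] mat_adjoint_diagonal_mat[OF L(2) Lm(1)] Lp(2) Lm(2) conj_neg
    by (simp_all add: nonneg_conjugate less_imp_le)
  have adj: "mat_adjoint P' = P'" "mat_adjoint N = N" "mat_adjoint P = P" "mat_adjoint Q = Q"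
    using V L P Q by (simp_all add: P'_def N_def mat_adjoint_mult adjL assoc_mult_mat_dim
        psd_mat_def hermitian_mat_def)
  have VpVm: "mat_adjoint Vp * Vm = 0\<^sub>m p q" using u unitary_block_cols_iff[OF V] by simp
  have "P' * N = Vp * Lp * ((mat_adjoint Vp * Vm) * (Lm * mat_adjoint Vm))"
    using V L by (simp add: P'_def N_def assoc_mult_mat_dim)
  also have "(mat_adjoint Vp * Vm) * (Lm * mat_adjoint Vm) = 0\<^sub>m p n"
    unfolding VpVm using V L by (intro left_mult_zero_mat mult_carrier_mat) auto
  also have "Vp * Lp * 0\<^sub>m p n = 0\<^sub>m n n"
    using V L by (intro right_mult_zero_mat mult_carrier_mat) auto
  finally have P'N: "P' * N = 0\<^sub>m n n" .
  have QP': "0 \<le> trace_mat (Q * P')"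
    unfolding P'_def by (rule trace_psd_mult_nonneg[OF Q V(1) L(1) Lp(1)]) (use Lp(2) in \<open>auto simp: less_imp_le\<close>)
  \<comment> \<open>\<open>N\<close> is the negative semidefinite part of \<open>A\<close>; negating
    \<open>Lm\<close> gives the nonnegative weights that the trace lemma asks for.\<close>
  have "0 \<le> trace_mat (P * (Vm * (- Lm) * mat_adjoint Vm))"
    by (rule trace_psd_mult_nonneg[OF P V(2)])
      (use L Lm in \<open>auto simp: diagonal_mat_def neg_nonneg_iff\<close>)
  also have "P * (Vm * (- Lm) * mat_adjoint Vm) = - (P * N)"
    using V L P by (simp add: N_def)
  also have "trace_mat \<dots> = - trace_mat (P * N)"
    using P N by (simp add: trace_mat_def sum_negf)
  finally have PN: "0 \<le> - trace_mat (P * N)" .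
  \<comment> \<open>\<open>D\<close> is the difference of the positive parts and
    \<open>F = Q - (- N)\<close> that of the negative parts, so that
    \<open>P - Q - A = D - F\<close>.\<close>
  define D where "D = P - P'"
  define F where "F = Q + N"
  have D: "D \<in> carrier_mat n n" and F: "F \<in> carrier_mat n n"
    using P P' Q N by (auto simp: D_def F_def)
  have adjDF: "mat_adjoint D = D" "mat_adjoint F = F"
    using mat_adjoint_minus[OF P(1) P'] mat_adjoint_add[OF Q(1) N] by (simp_all add: D_def F_def adj)
  have "P - Q - A = D - F"
    unfolding D_def F_def Aeq P'_def[symmetric] N_def[symmetric]
    using P Q P' N by (intro eq_matI) auto
  then have "of_real ((frobenius_norm (P - Q - A))\<^sup>2) = trace_mat ((D - F) * (D - F))"
    using mat_adjoint_minus[OF D F] by (simp add: frobenius_trace adjDF del: of_real_power)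
  also have "(D - F) * (D - F) = (D * D - F * D) - (D * F - F * F)"
    using mult_minus_distrib_mat[OF minus_carrier_mat[OF F, of D] D F]
      minus_mult_distrib_mat[OF D F D] minus_mult_distrib_mat[OF D F F] by simp
  also have "trace_mat \<dots> = trace_mat (D * D) - trace_mat (F * D) - (trace_mat (D * F) - trace_mat (F * F))"
    using D F by (subst trace_mat_minus[of _ n], (auto intro!: minus_carrier_mat mult_carrier_mat)[2])+ simp
  also have "trace_mat (F * D) = trace_mat (D * F)" by (rule trace_mat_comm[OF F D])
  \<comment> \<open>Of the four products in \<open>D * F\<close>, the two within a single splitting,
    \<open>P * Q\<close> and \<open>P' * N\<close>, vanish; the two mixed ones have traces of known
    sign.\<close>
  also have "trace_mat (D * F) = trace_mat (P * N) - trace_mat (Q * P')"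
  proof -
    have "D * F = (P * Q + P * N) - (P' * Q + P' * N)"
      unfolding D_def F_def using P P' Q N
        minus_mult_distrib_mat[OF P(1) P' add_carrier_mat[OF N, of Q]]
        mult_add_distrib_mat[OF P(1) Q(1) N] mult_add_distrib_mat[OF P' Q(1) N] by simp
    also have "\<dots> = P * N - P' * Q"
      unfolding PQ P'N using P P' Q N by (intro eq_matI) auto
    finally show ?thesis
      using P P' Q N trace_mat_comm[OF P' Q(1)] trace_mat_minus[of "P * N" n "P' * Q"] by auto
  qed
  finally have eq: "of_real ((frobenius_norm (P - Q - A))\<^sup>2) = trace_mat (D * D) +
    (trace_mat (F * F) + (- trace_mat (P * N) + trace_mat (Q * P') + (- trace_mat (P * N) + trace_mat (Q * P'))))"
    by simp
  have "trace_mat (D * D) + 0 \<le> of_real ((frobenius_norm (P - Q - A))\<^sup>2)"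
    unfolding eq
    by (intro add_left_mono add_nonneg_nonneg PN QP')
      (use trace_mult_adjoint_nonneg[of F] adjDF in simp)
  moreover have "trace_mat (D * D) = of_real ((frobenius_norm D)\<^sup>2)"
    by (simp add: frobenius_trace adjDF del: of_real_power)
  ultimately show ?thesis by (simp add: of_real_le_iff D_def P'_def del: of_real_power)
qed

section \<open>Semidefinite building blocks and uniqueness of the positive part\<close>

lemma psd_mat_uminus:
  fixes M :: "'a mat"
  assumes "nsd_mat M"
  shows "psd_mat (- M)"
proof -
  have sq: "dim_col M = dim_row M" using assms by (simp add: nsd_mat_def hermitian_mat_def)
  have "0 \<le> (- M *\<^sub>v v) \<bullet>c v" if v: "v \<in> carrier_vec (dim_row M)" for v
  proof -
    have "(- M *\<^sub>v v) \<bullet>c v = - ((M *\<^sub>v v) \<bullet>c v)"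
      using v sq by (simp add: uminus_mult_mat_vec)
    then show ?thesis using assms v by (simp add: nsd_mat_def neg_nonneg_iff)
  qed
  then show ?thesis
    using assms by (simp add: psd_mat_def nsd_mat_def hermitian_mat_def mat_adjoint_uminus)
qed

lemma psd_diagonal_mat:
  fixes D :: "'a mat"
  assumes D: "D \<in> carrier_mat p p" "diagonal_mat D" and nonneg: "\<forall>i<p. 0 \<le> D $$ (i, i)"
  shows "psd_mat D"
proof -
  have "mat_adjoint D = D"
    by (rule mat_adjoint_diagonal_mat[OF D]) (use nonneg nonneg_conjugate in blast)
  moreover have "0 \<le> (D *\<^sub>v v) \<bullet>c v" if v: "v \<in> carrier_vec p" for v
  proof -
    have "(D *\<^sub>v v) $ i = D $$ (i, i) * v $ i" if i: "i < p" for i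
    proof -
      have "(D *\<^sub>v v) $ i = (\<Sum>j<p. D $$ (i, j) * v $ j)"
        using D v i by (simp add: scalar_prod_def atLeast0LessThan)
      also have "\<dots> = (\<Sum>j<p. if j = i then D $$ (i, i) * v $ i else 0)"
        using D i by (intro sum.cong) (auto simp: diagonal_mat_def)
      finally show ?thesis using i by simp
    qed
    then have "(D *\<^sub>v v) \<bullet>c v = (\<Sum>i<p. D $$ (i, i) * (v $ i * conjugate (v $ i)))"
      using v by (simp add: cscalar_prod_sum mult.assoc)
    also have "0 \<le> \<dots>"
      using nonneg by (intro sum_nonneg nonneg_mult conjugate_square_positive) simp_all
    finally show ?thesis .
  qed
  ultimately show ?thesis using D by (simp add: psd_mat_def hermitian_mat_def)
qed

lemma Pi_plus_eq:
  fixes A :: "'a mat"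
  assumes A: "A \<in> carrier_mat n n" and dec: "is_eig_decomp A Vp Lp Vm Lm"
  shows "Pi_plus A = Vp * Lp * mat_adjoint Vp"
  unfolding Pi_plus_def
proof (rule the_equality)
  show "\<exists>Vp' Lp' Vm' Lm'. is_eig_decomp A Vp' Lp' Vm' Lm' \<and>
      Vp * Lp * mat_adjoint Vp = Vp' * Lp' * mat_adjoint Vp'"
    using dec by blast
next
  fix P' assume "\<exists>Vp' Lp' Vm' Lm'. is_eig_decomp A Vp' Lp' Vm' Lm' \<and>
      P' = Vp' * Lp' * mat_adjoint Vp'"
  then obtain Vp' Lp' Vm' Lm' where dec': "is_eig_decomp A Vp' Lp' Vm' Lm'"
    and P': "P' = Vp' * Lp' * mat_adjoint Vp'" by blast
  obtain p' q' where V': "Vp' \<in> carrier_mat n p'" "Vm' \<in> carrier_mat n q'"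
    and L': "Lp' \<in> carrier_mat p' p'" "Lm' \<in> carrier_mat q' q'"
    by (rule is_eig_decompE[OF dec' A]) (rule that)
  obtain p q where
    V: "Vp \<in> carrier_mat n p" "Vm \<in> carrier_mat n q"
    and L: "Lp \<in> carrier_mat p p" "Lm \<in> carrier_mat q q"
    and u: "unitary_mat (four_block_mat Vp Vm (0\<^sub>m 0 p) (0\<^sub>m 0 q))"
    and Lp: "diagonal_mat Lp" "\<forall>i<p. 0 < Lp $$ (i, i)"
    and Lm: "diagonal_mat Lm" "\<forall>i<q. Lm $$ (i, i) \<le> 0"
    and Aeq: "A = Vp * Lp * mat_adjoint Vp + Vm * Lm * mat_adjoint Vm"
    by (rule is_eig_decompE[OF dec A]) (rule that)
  define P where "P = Vp * Lp * mat_adjoint Vp"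
  define Q where "Q = Vm * (- Lm) * mat_adjoint Vm"
  have carr: "P \<in> carrier_mat n n" "Q \<in> carrier_mat n n"
    unfolding P_def Q_def by (intro carrier_matI, use V L in simp_all)+
  have psdP: "psd_mat P"
    unfolding P_def using Lp L by (intro psd_mat_congruence[OF _ _ V(1)] psd_diagonal_mat) (auto simp: less_imp_le)
  have psdQ: "psd_mat Q"
    unfolding Q_def using Lm L
    by (intro psd_mat_congruence[OF _ _ V(2)] psd_diagonal_mat[of _ q])
      (auto simp: diagonal_mat_def neg_nonneg_iff)
  have VpVm: "mat_adjoint Vp * Vm = 0\<^sub>m p q" using u unitary_block_cols_iff[OF V] by simp
  have "P * Q = Vp * Lp * ((mat_adjoint Vp * Vm) * (- Lm * mat_adjoint Vm))"
    using V L by (simp add: P_def Q_def assoc_mult_mat_dim)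
  also have "(mat_adjoint Vp * Vm) * (- Lm * mat_adjoint Vm) = 0\<^sub>m p n"
    unfolding VpVm using V L by (intro left_mult_zero_mat mult_carrier_mat) auto
  also have "Vp * Lp * 0\<^sub>m p n = 0\<^sub>m n n"
    using V L by (intro right_mult_zero_mat mult_carrier_mat) auto
  finally have "P * Q = 0\<^sub>m n n" .
  \<comment> \<open>\<open>P\<close> and \<open>Q\<close> come from the decomposition
    \<open>dec\<close>, while \<open>P'\<close> comes from the competing one \<open>dec'\<close>;
    the right-hand side vanishes because \<open>A = P - Q\<close>.\<close>
  then have "(frobenius_norm (P - P'))\<^sup>2 \<le> (frobenius_norm (P - Q - A))\<^sup>2"
    unfolding P' by (rule frobenius_psd_parts_le[OF A dec' carr(1) psdP carr(2) psdQ])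
  also have "P - Q - A = 0\<^sub>m n n"
  proof -
    have "Vm * Lm * mat_adjoint Vm = - Q" using V L by (simp add: Q_def)
    then have "A = P + - Q" using Aeq by (simp add: P_def)
    then show ?thesis using carr by (intro eq_matI) auto
  qed
  also have "(frobenius_norm (0\<^sub>m n n :: 'a mat))\<^sup>2 = 0" by (simp add: frobenius_norm_def)
  finally have "frobenius_norm (P - P') = 0" by simp
  from frobenius_norm_eq_0[OF this] have z: "P - P' = 0\<^sub>m n n" using carr V' by (simp add: P')
  show "P' = Vp * Lp * mat_adjoint Vp"
    unfolding P_def[symmetric]
  proof (rule eq_matI)
    fix i j assume "i < dim_row P" "j < dim_col P"
    then show "P' $$ (i, j) = P $$ (i, j)"
      using arg_cong[OF z, of "\<lambda>M. M $$ (i, j)"] carr V' by (simp add: P' del: index_mult_mat(1))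
  qed (use carr V' in \<open>simp_all add: P'\<close>)
qed

subsection \<open>The spectral theorem\<close>

lemma exists_normalizing_scalar:
  fixes v :: "'a vec"
  assumes v: "v \<in> carrier_vec n" "v \<noteq> 0\<^sub>v n"
  obtains c where "(c \<cdot>\<^sub>v v) \<bullet>c (c \<cdot>\<^sub>v v) = 1"
proof -
  obtain r where r: "v \<bullet>c v = of_real r" "0 \<le> r"
    using nonneg_of_real[OF conjugate_square_ge_0_vec] by blast
  have "r \<noteq> 0" using r conjugate_square_eq_0_vec[OF v(1)] v(2) by auto
  then have r0: "0 < r" using r by simp
  \<comment> \<open>A real scalar is chosen so that conjugation fixes it and it enters the inner
    product as a square.\<close>
  let ?c = "of_real (1 / sqrt r) :: 'a"
  have "(?c \<cdot>\<^sub>v v) \<bullet>c (?c \<cdot>\<^sub>v v) = ?c * (?c * (v \<bullet>c v))"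
    using v cscalar_prod_smult[OF v(1) smult_carrier_vec[THEN iffD2, OF v(1)], of ?c ?c]
      cscalar_prod_smult[OF v(1) v(1), of ?c] by (simp only: conjugate_of_real)
  also have "\<dots> = of_real (1 / sqrt r * (1 / sqrt r * r))"
    by (simp only: r of_real_mult)
  also have "1 / sqrt r * (1 / sqrt r * r) = 1" using r0 by (simp add: field_simps)
  finally have "(?c \<cdot>\<^sub>v v) \<bullet>c (?c \<cdot>\<^sub>v v) = 1" unfolding of_real_1 .
  then show ?thesis by (rule that)
qed

text \<open>A normalised vector orthogonal to all previous ones is adjoined repeatedly; the
  induction runs over the number of missing vectors, with \<open>us\<close> arbitrary.\<close>

lemma orthonormal_list_completion:
  fixes us :: "'a vec list"
  assumes "orthonormal_list n us" "length us \<le> n"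
  obtains ws where "orthonormal_list n (us @ ws)" "length (us @ ws) = n"
  using assms
proof (induction "n - length us" arbitrary: us thesis)
  case 0
  then show ?case by (metis append_Nil2 diff_is_0_eq le_antisym)
next
  case (Suc d)
  from Suc.hyps(2) have lt: "length us < n" by simp
  obtain v where v: "v \<in> carrier_vec n" "v \<noteq> 0\<^sub>v n" "\<forall>u\<in>set us. v \<bullet>c u = 0"
    using exists_orthogonal_vec[of us n] lt Suc.prems(2) by (auto simp: orthonormal_list_def)
  obtain c where c: "(c \<cdot>\<^sub>v v) \<bullet>c (c \<cdot>\<^sub>v v) = 1" using exists_normalizing_scalar[OF v(1,2)] .
  have "\<forall>w\<in>set us. (c \<cdot>\<^sub>v v) \<bullet>c w = 0"
    using v cscalar_prod_smult(1)[OF v(1)] Suc.prems(2) by (auto simp: orthonormal_list_def)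
  with Suc.prems(2) c v have o: "orthonormal_list n (us @ [c \<cdot>\<^sub>v v])"
    by (intro orthonormal_list_snoc) auto
  have "\<exists>ws. orthonormal_list n ((us @ [c \<cdot>\<^sub>v v]) @ ws) \<and> length ((us @ [c \<cdot>\<^sub>v v]) @ ws) = n"
    by (rule Suc.hyps(1)[OF _ _ o]) (use Suc.hyps(2) lt in \<open>simp, blast, simp\<close>)
  then obtain ws where "orthonormal_list n ((us @ [c \<cdot>\<^sub>v v]) @ ws)"
    "length ((us @ [c \<cdot>\<^sub>v v]) @ ws) = n" by blast
  then show ?case using Suc.prems(1)[of "(c \<cdot>\<^sub>v v) # ws"] by simp
qed

text \<open>
  The orthogonal complement of the eigenvectors found so far is invariant under \<open>A\<close>; if the
  columns of \<open>W\<close> are an orthonormal basis of it, then \<open>W\<close> maps an eigenvector of the Hermitian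
  matrix \<open>W\<^sup>*AW\<close> to a new one of \<open>A\<close>.
\<close>

lemma orthonormal_eigenvectors_extend:
  fixes A :: "'a mat"
  assumes A: "A \<in> carrier_mat n n" and herm: "hermitian_mat A"
    and us: "orthonormal_list n us" and eig: "\<forall>u\<in>set us. \<exists>e. A *\<^sub>v u = e \<cdot>\<^sub>v u"
    and len: "length us < n"
  obtains u where "orthonormal_list n (us @ [u])" "\<exists>e. A *\<^sub>v u = e \<cdot>\<^sub>v u"
proof -
  have adjA: "mat_adjoint A = A" using herm by (simp add: hermitian_mat_def)
  obtain ws where ow: "orthonormal_list n (us @ ws)" and lw: "length (us @ ws) = n"
    using orthonormal_list_completion[OF us] len by (metis less_imp_le)
  define m where "m = length us"
  define p where "p = length ws"
  define V where "V = mat_of_cols n us"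
  define W where "W = mat_of_cols n ws"
  have V: "V \<in> carrier_mat n m" and W: "W \<in> carrier_mat n p"
    by (simp_all add: V_def W_def m_def p_def)
  have us_c: "set us \<subseteq> carrier_vec n" and ws_c: "set ws \<subseteq> carrier_vec n"
    and ows: "orthonormal_list n ws"
    using ow by (auto simp: orthonormal_list_def)
  have orth: "u \<bullet>c w = 0 \<and> w \<bullet>c u = 0" if "u \<in> set us" "w \<in> set ws" for u w
    using ow that by (auto simp: orthonormal_list_def)
  have u: "unitary_mat (four_block_mat V W (0\<^sub>m 0 m) (0\<^sub>m 0 p))"
    unfolding V_def W_def m_def p_def using us ows orth lw
    by (intro unitary_block_orthonormal_lists) auto
  from unitary_block_cols_iff[OF V W] u have WW: "mat_adjoint W * W = 1\<^sub>m p"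
    and WV: "mat_adjoint W * V = 0\<^sub>m p m" by simp_all
  have complete: "V * mat_adjoint V + W * mat_adjoint W = 1\<^sub>m n"
    by (rule unitary_block_cols_complete[OF V W u])
  have AW: "A * W \<in> carrier_mat n p" using A W by (rule mult_carrier_mat)
  \<comment> \<open>Invariance of the complement: moving \<open>A\<close> onto the eigenvector
    \<open>us ! i\<close> only rescales it, and \<open>ws ! j\<close> is orthogonal to it.\<close>
  have VAW: "mat_adjoint V * (A * W) = 0\<^sub>m m p"
  proof (rule eq_matI)
    fix i j assume "i < dim_row (0\<^sub>m m p :: 'a mat)" "j < dim_col (0\<^sub>m m p :: 'a mat)"
    then have i: "i < m" and j: "j < p" by simp_all
    have ui: "us ! i \<in> set us" "us ! i \<in> carrier_vec n" and wj: "ws ! j \<in> set ws" "ws ! j \<in> carrier_vec n"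
      using i j us_c ws_c by (auto simp: m_def p_def)
    obtain e where e: "A *\<^sub>v us ! i = e \<cdot>\<^sub>v us ! i" using eig ui by blast
    have "(mat_adjoint V * (A * W)) $$ (i, j) = col (A * W) j \<bullet>c col V i"
      by (rule index_adjoint_mult[OF V AW i j])
    also have "\<dots> = (A *\<^sub>v ws ! j) \<bullet>c us ! i"
      using col_mult2[OF A W j] i j ui wj by (simp add: V_def W_def m_def p_def)
    also have "\<dots> = conjugate e * (ws ! j \<bullet>c us ! i)"
      using cscalar_prod_adjoint[OF A wj(2) ui(2)] cscalar_prod_smult(2)[OF wj(2) ui(2)]
      by (simp add: adjA e)
    also have "\<dots> = 0" using orth[OF ui(1) wj(1)] by simp
    finally show "(mat_adjoint V * (A * W)) $$ (i, j) = 0\<^sub>m m p $$ (i, j)" using i j by simp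
  qed (use V W in simp_all)
  define B where "B = mat_adjoint W * (A * W)"
  have B: "B \<in> carrier_mat p p"
    unfolding B_def using mat_adjoint_carrier[OF W] AW by (rule mult_carrier_mat)
  have "hermitian_mat B"
    using A W B by (simp add: hermitian_mat_def B_def mat_adjoint_mult adjA assoc_mult_mat_dim)
  moreover have "0 < p" unfolding p_def using lw len by (cases ws) auto
  ultimately obtain e where "eigenvalue B e" using hermitian_eigenvalue[OF B] by blast
  then obtain z where z: "z \<in> carrier_vec p" "z \<noteq> 0\<^sub>v p" "B *\<^sub>v z = e \<cdot>\<^sub>v z"
    using B by (auto simp: eigenvalue_def eigenvector_def)
  \<comment> \<open>Inserting \<open>V V\<^sup>* + W W\<^sup>* = 1\<close> in front of
    \<open>A W\<close> leaves only the second summand, by \<open>VAW\<close>.\<close>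
  have "A * W = W * B"
  proof -
    have "1\<^sub>m n * (A * W) = V * mat_adjoint V * (A * W) + W * mat_adjoint W * (A * W)"
      unfolding complete[symmetric]
      by (rule add_mult_distrib_mat[OF _ _ AW]) (use V W in \<open>auto intro!: mult_carrier_mat\<close>)
    also have "V * mat_adjoint V * (A * W) = V * (mat_adjoint V * (A * W))"
      using V A by (intro assoc_mult_mat_dim) simp_all
    also have "\<dots> = 0\<^sub>m n p" unfolding VAW using V by simp
    also have "W * mat_adjoint W * (A * W) = W * B"
      unfolding B_def using W A by (intro assoc_mult_mat_dim) simp_all
    also have "0\<^sub>m n p + W * B = W * B" by (rule left_add_zero_mat[OF mult_carrier_mat[OF W B]])
    finally show ?thesis unfolding left_mult_one_mat[OF AW] .
  qed
  define y where "y = W *\<^sub>v z"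
  have y: "y \<in> carrier_vec n" unfolding y_def using W z(1) by (rule mult_mat_vec_carrier)
  have "A *\<^sub>v y = (A * W) *\<^sub>v z" unfolding y_def by (rule assoc_mult_mat_vec[OF A W z(1), symmetric])
  also have "\<dots> = W *\<^sub>v (B *\<^sub>v z)" unfolding \<open>A * W = W * B\<close> by (rule assoc_mult_mat_vec[OF W B z(1)])
  also have "\<dots> = e \<cdot>\<^sub>v y" unfolding z(3) y_def by (rule mult_mat_vec[OF W z(1)])
  finally have Ay: "A *\<^sub>v y = e \<cdot>\<^sub>v y" .
  \<comment> \<open>\<open>W\<close> has the left inverse \<open>W\<^sup>*\<close>, so the nonzero
    \<open>z\<close> cannot be mapped to zero.\<close>
  have Wy: "mat_adjoint W *\<^sub>v y = z"
  proof -
    have "mat_adjoint W *\<^sub>v y = (mat_adjoint W * W) *\<^sub>v z"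
      unfolding y_def by (rule assoc_mult_mat_vec[OF mat_adjoint_carrier[OF W] W z(1), symmetric])
    then show ?thesis unfolding WW using z(1) by simp
  qed
  have y0: "y \<noteq> 0\<^sub>v n"
  proof
    assume "y = 0\<^sub>v n"
    then have "z = 0\<^sub>v p" using Wy W by auto
    with z(2) show False ..
  qed
  have yu: "y \<bullet>c u = 0" if u: "u \<in> set us" for u
  proof -
    obtain i where i: "i < m" "u = us ! i" using u by (auto simp: in_set_conv_nth m_def)
    have uc: "u \<in> carrier_vec n" using u us_c by blast
    have "mat_adjoint W *\<^sub>v u = col (mat_adjoint W * V) i"
      using col_mult2[OF mat_adjoint_carrier[OF W] V i(1)] i uc by (simp add: V_def m_def)
    also have "\<dots> = 0\<^sub>v p" unfolding WV using i by simp
    finally have "y \<bullet>c u = z \<bullet>c 0\<^sub>v p"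
      unfolding y_def using cscalar_prod_adjoint[OF W z(1) uc] by simp
    then show ?thesis using z(1) by (simp add: cscalar_prod_sum)
  qed
  obtain c where c: "(c \<cdot>\<^sub>v y) \<bullet>c (c \<cdot>\<^sub>v y) = 1" using exists_normalizing_scalar[OF y y0] .
  have "orthonormal_list n (us @ [c \<cdot>\<^sub>v y])"
    using us c y yu us_c cscalar_prod_smult(1)[OF y]
    by (intro orthonormal_list_snoc) auto
  moreover have "A *\<^sub>v (c \<cdot>\<^sub>v y) = e \<cdot>\<^sub>v (c \<cdot>\<^sub>v y)"
    using mult_mat_vec[OF A y] by (simp add: Ay smult_smult_assoc mult.commute)
  ultimately show ?thesis using that by blast
qed

lemma orthonormal_eigenvectors_exist:
  fixes A :: "'a mat"
  assumes A: "A \<in> carrier_mat n n" and herm: "hermitian_mat A"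
  obtains us where "orthonormal_list n us" "length us = n" "\<forall>u\<in>set us. \<exists>e. A *\<^sub>v u = e \<cdot>\<^sub>v u"
proof -
  have "\<exists>us. orthonormal_list n us \<and> length us = m \<and> (\<forall>u\<in>set us. \<exists>e. A *\<^sub>v u = e \<cdot>\<^sub>v u)"
    if "m \<le> n" for m
    using that
  proof (induction m)
    case 0
    then show ?case by (intro exI[of _ "[]"]) (simp add: orthonormal_list_def)
  next
    case (Suc m)
    then obtain us where us: "orthonormal_list n us" "length us = m"
      "\<forall>u\<in>set us. \<exists>e. A *\<^sub>v u = e \<cdot>\<^sub>v u" by auto
    obtain u where "orthonormal_list n (us @ [u])" "\<exists>e. A *\<^sub>v u = e \<cdot>\<^sub>v u"
      using orthonormal_eigenvectors_extend[OF A herm us(1,3)] us(2) Suc.prems by auto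
    with us show ?case by (intro exI[of _ "us @ [u]"]) auto
  qed
  from this[of n] show ?thesis using that by blast
qed

text \<open>An orthonormal eigenbasis is split by the sign of the eigenvalue, and \<open>A\<close>
  is applied to the resolution of the identity given by the two groups of columns.\<close>

lemma is_eig_decomp_exists:
  fixes A :: "'a mat"
  assumes A: "A \<in> carrier_mat n n" and herm: "hermitian_mat A"
  obtains Vp Lp Vm Lm where "is_eig_decomp A Vp Lp Vm Lm"
proof -
  obtain us where us: "orthonormal_list n us" and len: "length us = n"
    and eig: "\<forall>u\<in>set us. \<exists>e. A *\<^sub>v u = e \<cdot>\<^sub>v u"
    by (rule orthonormal_eigenvectors_exist[OF A herm])
  from bchoice[OF eig] obtain ev where ev: "\<forall>u\<in>set us. A *\<^sub>v u = ev u \<cdot>\<^sub>v u" by blast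
  have us_c: "set us \<subseteq> carrier_vec n" using us by (simp add: orthonormal_list_def)
  \<comment> \<open>The scalar order is only partial: the negation of \<open>0 < ev u\<close> yields
    \<open>ev u \<le> 0\<close> because eigenvalues of a Hermitian matrix are real.\<close>
  have nonpos: "ev u \<le> 0" if u: "u \<in> set us" "\<not> 0 < ev u" for u
  proof -
    have uc: "u \<in> carrier_vec n" using u us_c by blast
    have "u \<noteq> 0\<^sub>v n" using us u(1) conjugate_square_eq_0_vec[OF uc] by (auto simp: orthonormal_list_def)
    then have "conjugate (ev u) = ev u"
      using hermitian_eigenvalue_conjugate[OF A herm uc] ev u(1) by blast
    then obtain r where r: "ev u = of_real r" by (rule self_conjugate_of_real)
    have "\<not> 0 < r" using u(2) by (auto simp: r less_le)
    then have "0 \<le> (of_real (- r) :: 'a)" unfolding of_real_nonneg_iff by simp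
    then show ?thesis by (simp add: r neg_nonneg_iff)
  qed
  define D where "D = (\<lambda>ws. mat (length ws) (length ws) (\<lambda>(i, j). if i = j then ev (ws ! i) else 0))"
  have D: "D ws \<in> carrier_mat (length ws) (length ws)" "diagonal_mat (D ws)" for ws
    by (auto simp: D_def diagonal_mat_def)
  \<comment> \<open>Stated for every list of vectors from \<open>us\<close>, so that it serves both
    groups of eigenvectors.\<close>
  have AV: "A * mat_of_cols n ws = mat_of_cols n ws * D ws" if ws: "set ws \<subseteq> set us" for ws
  proof (rule eq_matI)
    let ?W = "mat_of_cols n ws"
    fix i j assume "i < dim_row (?W * D ws)" "j < dim_col (?W * D ws)"
    then have i: "i < n" and j: "j < length ws" by (simp_all add: D_def)
    have wj: "ws ! j \<in> set us" "ws ! j \<in> carrier_vec n" using j ws us_c nth_mem by blast+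
    have "(A * ?W) $$ (i, j) = col (A * ?W) j $ i" using A i j by simp
    also have "col (A * ?W) j = ev (ws ! j) \<cdot>\<^sub>v (ws ! j)"
      using col_mult2[OF A mat_of_cols_carrier(1) j] j wj ev by simp
    also have "\<dots> $ i = ?W $$ (i, j) * ev (ws ! j)"
      using wj i j by (simp add: mat_of_cols_index mult.commute)
    also have "\<dots> = (\<Sum>l<length ws. if l = j then ?W $$ (i, j) * ev (ws ! j) else 0)"
      using j by simp
    also have "\<dots> = (\<Sum>l<length ws. ?W $$ (i, l) * D ws $$ (l, j))"
      using j by (intro sum.cong) (auto simp: D_def)
    also have "\<dots> = (?W * D ws) $$ (i, j)"
      using i j by (simp add: D_def scalar_prod_def atLeast0LessThan mat_of_cols_index)
    finally show "(A * ?W) $$ (i, j) = (?W * D ws) $$ (i, j)" .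
  qed (use A in \<open>simp_all add: D_def\<close>)
  define ps where "ps = filter (\<lambda>u. 0 < ev u) us"
  define ms where "ms = filter (\<lambda>u. \<not> 0 < ev u) us"
  define Vp where "Vp = mat_of_cols n ps"
  define Vm where "Vm = mat_of_cols n ms"
  have V: "Vp \<in> carrier_mat n (length ps)" "Vm \<in> carrier_mat n (length ms)"
    by (simp_all add: Vp_def Vm_def)
  have unit: "unitary_mat (four_block_mat Vp Vm (0\<^sub>m 0 (length ps)) (0\<^sub>m 0 (length ms)))"
    unfolding Vp_def Vm_def
  proof (rule unitary_block_orthonormal_lists)
    show "orthonormal_list n ps" "orthonormal_list n ms"
      unfolding ps_def ms_def by (rule orthonormal_list_filter[OF us])+
    show "\<forall>u\<in>set ps. \<forall>w\<in>set ms. u \<bullet>c w = 0 \<and> w \<bullet>c u = 0"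
      using us by (auto simp: ps_def ms_def orthonormal_list_def)
    show "length ps + length ms = n"
      unfolding ps_def ms_def sum_length_filter_compl by (rule len)
  qed
  have "A * 1\<^sub>m n = A * (Vp * mat_adjoint Vp) + A * (Vm * mat_adjoint Vm)"
    unfolding unitary_block_cols_complete[OF V unit, symmetric]
    by (rule mult_add_distrib_mat[OF A]) (use V in \<open>auto intro!: mult_carrier_mat\<close>)
  also have "A * (Vp * mat_adjoint Vp) = A * Vp * mat_adjoint Vp"
    using A V by (intro assoc_mult_mat_dim[symmetric]) simp_all
  also have "A * Vp = Vp * D ps" unfolding Vp_def by (rule AV) (simp add: ps_def)
  also have "A * (Vm * mat_adjoint Vm) = A * Vm * mat_adjoint Vm"
    using A V by (intro assoc_mult_mat_dim[symmetric]) simp_all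
  also have "A * Vm = Vm * D ms" unfolding Vm_def by (rule AV) (auto simp: ms_def)
  finally have A_eq: "A = Vp * D ps * mat_adjoint Vp + Vm * D ms * mat_adjoint Vm"
    unfolding right_mult_one_mat[OF A] .
  have "\<forall>i<length ps. 0 < D ps $$ (i, i)"
    using nth_mem[of _ ps] by (auto simp: D_def ps_def)
  moreover have "\<forall>i<length ms. D ms $$ (i, i) \<le> 0"
  proof (intro allI impI)
    fix i assume i: "i < length ms"
    then have "ms ! i \<in> set ms" by simp
    then have "ev (ms ! i) \<le> 0" by (intro nonpos) (simp_all add: ms_def)
    then show "D ms $$ (i, i) \<le> 0" using i by (simp add: D_def)
  qed
  ultimately have "is_eig_decomp A Vp (D ps) Vm (D ms)"
    unfolding is_eig_decomp_def carrier_matD(1)[OF A] using V D unit A_eq by blast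
  then show ?thesis by (rule that)
qed

subsection \<open>The residual bound\<close>

lemma projection_residual_bound:
  fixes A V L W :: "'a mat"
  assumes kn: "k \<le> n" and A: "A \<in> carrier_mat n n" and herm: "hermitian_mat A"
    and V: "V \<in> carrier_mat n k" "orthonormal_cols V"
    and L: "L \<in> carrier_mat k k" "psd_mat L" and Leq: "L = mat_adjoint V * A * V"
    and W: "W \<in> carrier_mat n (n - k)" "orthonormal_cols W"
    and sp: "vec_space.col_space n W = mat_kernel (mat_adjoint V)"
    and nsd: "nsd_mat (mat_adjoint W * A * W)"
  shows "(frobenius_norm (V * L * mat_adjoint V - Pi_plus A))\<^sup>2
    \<le> 2 * (frobenius_norm (A * V - V * L))\<^sup>2"
proof -
  obtain Vp Lp Vm Lm where dec: "is_eig_decomp A Vp Lp Vm Lm"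
    by (rule is_eig_decomp_exists[OF A herm])
  note V' = mat_adjoint_carrier[OF V(1)] and W' = mat_adjoint_carrier[OF W(1)]
  have VV: "mat_adjoint V * V = 1\<^sub>m k" and WW: "mat_adjoint W * W = 1\<^sub>m (n - k)"
    using V W orthonormal_cols_iff by blast+
  \<comment> \<open>Each column of \<open>W\<close> is the image of a unit vector, so it lies in the
    column space, which is the kernel of \<open>V\<^sup>*\<close>.\<close>
  have VW: "mat_adjoint V * W = 0\<^sub>m k (n - k)"
  proof (rule eq_matI)
    fix i j assume ij: "i < dim_row (0\<^sub>m k (n - k) :: 'a mat)" "j < dim_col (0\<^sub>m k (n - k) :: 'a mat)"
    have "col W j \<in> vec_space.col_space n W"
      unfolding vec_space.col_space_eq[OF W(1)]
      using mult_mat_unit_vec[OF W(1), of j] W ij by (auto intro!: bexI[of _ "unit_vec (n - k) j"])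
    then have "mat_adjoint V *\<^sub>v col W j = 0\<^sub>v k"
      using V by (simp add: sp mat_kernel_def)
    then have "col (mat_adjoint V * W) j = 0\<^sub>v k"
      using col_mult2[OF V' W(1)] ij by simp
    then have "col (mat_adjoint V * W) j $ i = 0" using ij by simp
    then show "(mat_adjoint V * W) $$ (i, j) = 0\<^sub>m k (n - k) $$ (i, j)"
      using ij V W by (simp del: index_mult_mat(1) col_mult2)
  qed (use V W in simp_all)
  have WV: "mat_adjoint W * V = 0\<^sub>m (n - k) k"
  proof -
    have "mat_adjoint W * V = mat_adjoint (mat_adjoint V * W)"
      using V W by (simp add: mat_adjoint_mult)
    also have "\<dots> = 0\<^sub>m (n - k) k" unfolding VW by (rule eq_matI) auto
    finally show ?thesis .
  qed
  define H where "H = V * mat_adjoint V"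
  define K where "K = W * mat_adjoint W"
  have H: "H \<in> carrier_mat n n" and K: "K \<in> carrier_mat n n"
    unfolding H_def K_def using V(1) V' W(1) W' by (auto intro: mult_carrier_mat)
  \<comment> \<open>\<open>k \<le> n\<close> matters for the truncated subtraction: it gives
    \<open>k + (n - k) = n\<close>, so the concatenation of \<open>V\<close> and \<open>W\<close> is
    square.\<close>
  have HK: "H + K = 1\<^sub>m n"
    unfolding H_def K_def
    by (rule unitary_block_cols_complete[OF V(1) W(1)])
      (use unitary_block_cols_iff[OF V(1) W(1)] kn VV WW VW WV in simp)
  have adjA: "mat_adjoint A = A" using herm by (simp add: hermitian_mat_def)
  have adjHK: "mat_adjoint H = H" "mat_adjoint K = K"
    using V W by (simp_all add: H_def K_def mat_adjoint_mult)
  define M where "M = mat_adjoint W * A * W"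
  have M: "M \<in> carrier_mat (n - k) (n - k)"
    unfolding M_def by (intro carrier_matI) (use W in simp_all)
  define P where "P = V * L * mat_adjoint V"
  define Q where "Q = W * (- M) * mat_adjoint W"
  have P: "P \<in> carrier_mat n n" and Q: "Q \<in> carrier_mat n n"
    unfolding P_def Q_def by (intro carrier_matI, use V W L in simp_all)+
  have psd: "psd_mat P" "psd_mat Q"
    unfolding P_def Q_def
    by (intro psd_mat_congruence[OF L V(1)])
      (intro psd_mat_congruence[OF _ psd_mat_uminus W(1)], use M nsd in \<open>simp_all add: M_def\<close>)
  have "P * Q = V * L * ((mat_adjoint V * W) * (- M * mat_adjoint W))"
    using V W L M by (simp add: P_def Q_def assoc_mult_mat_dim)
  also have "(mat_adjoint V * W) * (- M * mat_adjoint W) = 0\<^sub>m k n"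
    unfolding VW using W' M by (intro left_mult_zero_mat mult_carrier_mat) auto
  also have "V * L * 0\<^sub>m k n = 0\<^sub>m n n"
    using V L by (intro right_mult_zero_mat mult_carrier_mat) auto
  finally have PQ: "P * Q = 0\<^sub>m n n" .
  define R where "R = A * V - V * L"
  have R: "R \<in> carrier_mat n k"
    unfolding R_def by (intro carrier_matI) (use V L A in simp_all)
  define S where "S = R * mat_adjoint V"
  have S: "S \<in> carrier_mat n n" unfolding S_def using R V' by (rule mult_carrier_mat)
  have S': "mat_adjoint S \<in> carrier_mat n n" using S by (rule mat_adjoint_carrier)
  have AH: "A * H \<in> carrier_mat n n" and HAH: "H * (A * H) \<in> carrier_mat n n"
    and KAH: "K * (A * H) \<in> carrier_mat n n" and AK: "A * K \<in> carrier_mat n n"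
    and HAK: "H * (A * K) \<in> carrier_mat n n" and KAK: "K * (A * K) \<in> carrier_mat n n"
    using A H K by (auto intro!: mult_carrier_mat)
  have P_eq: "P = H * (A * H)"
    using V A by (simp add: P_def H_def Leq assoc_mult_mat_dim)
  have Q_eq: "Q = - (K * (A * K))"
    using W A M by (simp add: Q_def K_def M_def assoc_mult_mat_dim)
  have "1\<^sub>m n * (A * H) = H * (A * H) + K * (A * H)"
    unfolding HK[symmetric] by (rule add_mult_distrib_mat[OF H K AH])
  then have AH_eq: "A * H = H * (A * H) + K * (A * H)" unfolding left_mult_one_mat[OF AH] .
  have "1\<^sub>m n * (A * K) = H * (A * K) + K * (A * K)"
    unfolding HK[symmetric] by (rule add_mult_distrib_mat[OF H K AK])
  then have AK_eq: "A * K = H * (A * K) + K * (A * K)" unfolding left_mult_one_mat[OF AK] .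
  have "A * 1\<^sub>m n = A * H + A * K"
    unfolding HK[symmetric] by (rule mult_add_distrib_mat[OF A H K])
  then have A_eq: "A = A * H + A * K" unfolding right_mult_one_mat[OF A] .
  \<comment> \<open>Because \<open>L = V\<^sup>* A V\<close>, this is \<open>A H - H A H\<close>,
    the part of \<open>A H\<close> that \<open>K\<close> retains.\<close>
  have "S = A * V * mat_adjoint V - V * L * mat_adjoint V"
    unfolding S_def R_def
    by (rule minus_mult_distrib_mat[OF mult_carrier_mat[OF A V(1)] mult_carrier_mat[OF V(1) L(1)] V'])
  also have "\<dots> = A * H - H * (A * H)"
    using V A by (simp add: H_def Leq assoc_mult_mat_dim)
  also have "\<dots> = K * (A * H)"
  proof -
    have "X + Y - X = Y" if "X \<in> carrier_mat n n" "Y \<in> carrier_mat n n" for X Y :: "'a mat"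
      using that by (intro eq_matI) auto
    from this[OF HAH KAH] show ?thesis unfolding AH_eq[symmetric] .
  qed
  finally have S_eq: "S = K * (A * H)" .
  have S'_eq: "mat_adjoint S = H * (A * K)"
    using A H K by (simp add: S_eq mat_adjoint_mult adjHK adjA assoc_mult_mat_dim)
  have diff: "P - Q - A = - (S + mat_adjoint S)"
  proof -
    have "K * (A * K) = - Q" by (simp add: Q_eq)
    then have "A * H = P + S" "A * K = mat_adjoint S + - Q"
      using AH_eq AK_eq unfolding P_eq[symmetric] S_eq[symmetric] S'_eq[symmetric] by auto
    then have "A = (P + S) + (mat_adjoint S + - Q)" using A_eq by metis
    then show ?thesis using P Q S S' A by (intro eq_matI) auto
  qed
  have "mat_adjoint V * R = 0\<^sub>m k k"
  proof -
    have "mat_adjoint V * R = mat_adjoint V * (A * V) - mat_adjoint V * (V * L)"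
      unfolding R_def
      by (rule mult_minus_distrib_mat[OF V' mult_carrier_mat[OF A V(1)] mult_carrier_mat[OF V(1) L(1)]])
    also have "mat_adjoint V * (V * L) = (mat_adjoint V * V) * L"
      using V L by (simp add: assoc_mult_mat_dim)
    also have "\<dots> = L" unfolding VV using L by simp
    also have "mat_adjoint V * (A * V) = L" using V A by (simp add: Leq assoc_mult_mat_dim)
    finally show ?thesis using L by simp
  qed
  moreover have "S * S = R * ((mat_adjoint V * R) * mat_adjoint V)"
    using R V by (simp add: S_def assoc_mult_mat_dim)
  ultimately have SS: "S * S = 0\<^sub>m n n" using R V by simp
  have S'S': "mat_adjoint S * mat_adjoint S = 0\<^sub>m n n"
  proof -
    have "mat_adjoint S * mat_adjoint S = mat_adjoint (S * S)" using S by (simp add: mat_adjoint_mult)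
    also have "\<dots> = 0\<^sub>m n n" unfolding SS by (rule eq_matI) auto
    finally show ?thesis .
  qed
  \<comment> \<open>Multiplying by \<open>V\<^sup>*\<close> on the right preserves the Frobenius
    norm, as \<open>V\<^sup>* V = 1\<close>.\<close>
  have SS': "S * mat_adjoint S = R * mat_adjoint R"
  proof -
    have "S * mat_adjoint S = R * ((mat_adjoint V * V) * mat_adjoint R)"
      using R V by (simp add: S_def mat_adjoint_mult assoc_mult_mat_dim)
    then show ?thesis unfolding VV using R by simp
  qed
  let ?X = "S + mat_adjoint S"
  have X: "?X \<in> carrier_mat n n" using S' by simp
  have adjX: "mat_adjoint ?X = ?X"
    using comm_add_mat[OF S' S] by (simp add: mat_adjoint_add[OF S S'])
  have "of_real ((frobenius_norm (P - Q - A))\<^sup>2) = trace_mat (?X * ?X)"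
  proof -
    have "- Y * - Y = Y * Y" if "Y \<in> carrier_mat n n" for Y :: "'a mat" using that by simp
    from this[OF X] show ?thesis
      unfolding diff frobenius_trace mat_adjoint_uminus adjX by simp
  qed
  also have "?X * ?X = (S * S + S * mat_adjoint S) + (mat_adjoint S * S + mat_adjoint S * mat_adjoint S)"
    using add_mult_distrib_mat[OF S S' X] mult_add_distrib_mat[OF S S S'] mult_add_distrib_mat[OF S' S S']
    by simp
  also have "\<dots> = S * mat_adjoint S + mat_adjoint S * S"
    unfolding SS S'S'
    using left_add_zero_mat[OF mult_carrier_mat[OF S S']] right_add_zero_mat[OF mult_carrier_mat[OF S' S]]
    by simp
  also have "trace_mat \<dots> = trace_mat (S * mat_adjoint S) + trace_mat (mat_adjoint S * S)"
    by (rule trace_mat_add[OF mult_carrier_mat[OF S S'] mult_carrier_mat[OF S' S]])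
  also have "\<dots> = of_real (2 * (frobenius_norm R)\<^sup>2)"
    unfolding trace_mat_comm[OF S' S] SS' of_real_mult frobenius_trace by simp
  finally have "(frobenius_norm (P - Q - A))\<^sup>2 = 2 * (frobenius_norm R)\<^sup>2"
    by (simp only: of_real_eq_iff)
  then show ?thesis
    using frobenius_psd_parts_le[OF A dec P psd(1) Q psd(2) PQ]
    by (simp add: Pi_plus_eq[OF A dec] P_def R_def)
qed

end

section \<open>Existence of eigenvalues over the complex and the real numbers\<close>

lemma complex_eigenvalue_exists:
  fixes A :: "complex mat"
  assumes A: "A \<in> carrier_mat n n" and n: "0 < n"
  shows "\<exists>e. eigenvalue A e"
proof -
  from char_poly_factorized[OF A] obtain as where as: "char_poly A = (\<Prod>a\<leftarrow>as. [:- a, 1:])" "length as = n"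
    by blast
  \<comment> \<open>\<open>0 < n\<close> guarantees at least one linear factor.\<close>
  with n obtain a as' where "as = a # as'" by (cases as) auto
  then have "poly (char_poly A) a = 0" by (simp add: as)
  then show ?thesis using eigenvalue_root_char_poly[OF A] by blast
qed

lemma hermitian_scalars_complex: "hermitian_scalars TYPE(complex)"
proof
  show "a * conjugate a = of_real ((norm a)\<^sup>2)" for a :: complex
    using complex_norm_square[of a] by (simp del: of_real_power)
  show "conjugate a = a" if "0 \<le> a" for a :: complex
    using that by (simp add: less_eq_complex_def complex_eq_iff)
qed (rule complex_eigenvalue_exists)

text \<open>Regarded as a complex matrix, \<open>A\<close> is Hermitian, so an eigenvalue found over
  the complex numbers is real.\<close>

lemma hermitian_eigenvalue_real:
  fixes A :: "real mat"
  assumes A: "A \<in> carrier_mat n n" and herm: "hermitian_mat A" and n: "0 < n"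
  shows "\<exists>e. eigenvalue A e"
proof -
  let ?C = "map_mat complex_of_real A"
  have C: "?C \<in> carrier_mat n n" using A by simp
  have "mat_adjoint ?C = ?C"
  proof (rule eq_matI)
    fix i j assume "i < dim_row ?C" "j < dim_col ?C"
    then have ij: "i < n" "j < n" using A by simp_all
    have "A $$ (j, i) = mat_adjoint A $$ (i, j)" using A ij by simp
    also have "\<dots> = A $$ (i, j)" using herm by (simp add: hermitian_mat_def)
    finally show "mat_adjoint ?C $$ (i, j) = ?C $$ (i, j)" using A ij by simp
  qed (use A in simp_all)
  then have hC: "hermitian_mat ?C" using A by (simp add: hermitian_mat_def)
  obtain e where e: "eigenvalue ?C e" using complex_eigenvalue_exists[OF C n] by blast
  then obtain v where "v \<in> carrier_vec n" "v \<noteq> 0\<^sub>v n" "?C *\<^sub>v v = e \<cdot>\<^sub>v v"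
    using C by (auto simp: eigenvalue_def eigenvector_def)
  then have "conjugate e = e" by (rule hermitian_eigenvalue_conjugate[OF C hC])
  then obtain r where r: "e = complex_of_real r"
    by (rule hermitian_scalars.self_conjugate_of_real[OF hermitian_scalars_complex])
  \<comment> \<open>The embedding of the reals commutes with forming the characteristic polynomial,
    so \<open>r\<close> is already a root over the reals; no real eigenvector has to be extracted
    from the complex one.\<close>
  have "poly (char_poly ?C) e = 0" using e eigenvalue_root_char_poly[OF C] by simp
  then have "complex_of_real (poly (char_poly A) r) = 0"
    unfolding r of_real_hom.char_poly_hom[OF A] of_real_hom.poly_map_poly .
  then have "eigenvalue A r" using eigenvalue_root_char_poly[OF A] by simp
  then show ?thesis ..
qed

lemma hermitian_scalars_real: "hermitian_scalars TYPE(real)"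
  by unfold_locales (simp_all add: power2_eq_square hermitian_eigenvalue_real)

theorem corollary2p2:
  shows "(\<forall>(n::nat) (k::nat) (A::real mat) (V::real mat) (L::real mat) (W::real mat).
          k \<le> n \<longrightarrow>
          A \<in> carrier_mat n n \<longrightarrow> hermitian_mat A \<longrightarrow>
          V \<in> carrier_mat n k \<longrightarrow> orthonormal_cols V \<longrightarrow>
          L \<in> carrier_mat k k \<longrightarrow> psd_mat L \<longrightarrow>
          L = mat_adjoint V * A * V \<longrightarrow>
          W \<in> carrier_mat n (n - k) \<longrightarrow> orthonormal_cols W \<longrightarrow>
          vec_space.col_space n W = mat_kernel (mat_adjoint V) \<longrightarrow>
          nsd_mat (mat_adjoint W * A * W) \<longrightarrow>
          (let R = A * V - V * L in
             (frobenius_norm (V * L * mat_adjoint V - Pi_plus A))\<^sup>2 \<le> 2 * (frobenius_norm R)\<^sup>2))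
       \<and>
         (\<forall>(n::nat) (k::nat) (A::complex mat) (V::complex mat) (L::complex mat) (W::complex mat).
          k \<le> n \<longrightarrow>
          A \<in> carrier_mat n n \<longrightarrow> hermitian_mat A \<longrightarrow>
          V \<in> carrier_mat n k \<longrightarrow> orthonormal_cols V \<longrightarrow>
          L \<in> carrier_mat k k \<longrightarrow> psd_mat L \<longrightarrow>
          L = mat_adjoint V * A * V \<longrightarrow>
          W \<in> carrier_mat n (n - k) \<longrightarrow> orthonormal_cols W \<longrightarrow>
          vec_space.col_space n W = mat_kernel (mat_adjoint V) \<longrightarrow>
          nsd_mat (mat_adjoint W * A * W) \<longrightarrow>
          (let R = A * V - V * L in
             (frobenius_norm (V * L * mat_adjoint V - Pi_plus A))\<^sup>2 \<le> 2 * (frobenius_norm R)\<^sup>2))"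
  unfolding Let_def
  by (intro conjI allI impI;
      rule hermitian_scalars.projection_residual_bound[OF hermitian_scalars_real]
        hermitian_scalars.projection_residual_bound[OF hermitian_scalars_complex]; assumption)

end
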